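(* Let $X$ be a complex Banach space and $T\in B(X)$ an $(m,\infty)$-isometry (where $m\in\mathbb{N}^+$). Then the approximate point spectrum $\sigma_{\mathrm{ap}}(T)$ of $T$ lies in the unit circle $\mathbb{T}=\{z\in\mathbb{C}:|z|=1\}$, and the spectral radius $r(T)$ is equal to $1$.
   Context: $\mathbb{N}^+$ denotes the positive integers; $B(X)$ is the algebra of bounded linear operators on $X$. For $m\in\mathbb{N}^+$, an operator $T\in B(X)$ is called an $(m,\infty)$-isometry if for all $x\in X$ $$\max_{\substack{k=0,\dots,m\\ k\text{ even}}}\|T^kx\|=\max_{\substack{k=0,\dots,m\\ k\text{ odd}}}\|T^kx\|.$$ The approximate point spectrum of $T$ is the set of $\lambda\in\mathbb{C}$ such that $T-\lambda I$ is not bounded below. *)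

theory Defs
  imports "HOL-Analysis.Analysis"
begin

text \<open>
  A complex normed space is a real normed space with a complex scalar multiplication that
  extends the real one and satisfies the vector space axioms and homogeneity of the norm.
\<close>

class complex_normed_vector = real_normed_vector +
  fixes scaleC :: "complex \<Rightarrow> 'a \<Rightarrow> 'a"  (infixr "*\<^sub>C" 75)
  assumes scaleC_add_right: "c *\<^sub>C (x + y) = c *\<^sub>C x + c *\<^sub>C y"
    and scaleC_add_left: "(c + d) *\<^sub>C x = c *\<^sub>C x + d *\<^sub>C x"
    and scaleC_scaleC: "c *\<^sub>C d *\<^sub>C x = (c * d) *\<^sub>C x"
    and scaleC_of_real: "complex_of_real r *\<^sub>C x = r *\<^sub>R x"
    and norm_scaleC: "norm (c *\<^sub>C x) = cmod c * norm x"

class complex_banach = complex_normed_vector + complete_space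

instantiation complex :: complex_banach
begin

definition scaleC_complex :: "complex \<Rightarrow> complex \<Rightarrow> complex"
  where "scaleC_complex c x = c * x"

instance
  by standard (simp_all add: scaleC_complex_def algebra_simps norm_mult scaleR_conv_of_real)

end

definition bounded_clinear :: "('a::complex_normed_vector \<Rightarrow> 'b::complex_normed_vector) \<Rightarrow> bool"
  where "bounded_clinear T \<longleftrightarrow> bounded_linear T \<and> (\<forall>c x. T (c *\<^sub>C x) = c *\<^sub>C T x)"

definition m_infty_isometry :: "nat \<Rightarrow> ('a::real_normed_vector \<Rightarrow> 'a) \<Rightarrow> bool"
  where "m_infty_isometry m T \<longleftrightarrow>
    (\<forall>x. Max ((\<lambda>k. norm ((T ^^ k) x)) ` {k. k \<le> m \<and> even k}) =
         Max ((\<lambda>k. norm ((T ^^ k) x)) ` {k. k \<le> m \<and> odd k}))"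

definition bounded_below :: "('a::real_normed_vector \<Rightarrow> 'b::real_normed_vector) \<Rightarrow> bool"
  where "bounded_below S \<longleftrightarrow> (\<exists>c>0. \<forall>x. c * norm x \<le> norm (S x))"

definition approx_point_spectrum :: "('a::complex_normed_vector \<Rightarrow> 'a) \<Rightarrow> complex set"
  where "approx_point_spectrum T = {l. \<not> bounded_below (\<lambda>x. T x - l *\<^sub>C x)}"

definition spectrum :: "('a::complex_normed_vector \<Rightarrow> 'a) \<Rightarrow> complex set"
  where "spectrum T =
    {l. \<not> (\<exists>S. bounded_clinear S \<and> S \<circ> (\<lambda>x. T x - l *\<^sub>C x) = id \<and> (\<lambda>x. T x - l *\<^sub>C x) \<circ> S = id)}"

text \<open>
  The supremum is the intended one when the spectrum is nonempty and bounded, as it is for every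
  bounded operator on a nonzero complex Banach space. On the zero space the spectrum is empty and
  the value is meaningless.
\<close>

definition spectral_radius :: "('a::complex_normed_vector \<Rightarrow> 'a) \<Rightarrow> real"
  where "spectral_radius T = (SUP l\<in>spectrum T. cmod l)"

end

theory Submission
  imports Defs
begin

text \<open>
  The function \<open>N x = max {\<parallel>T\<^sup>k x\<parallel> : k \<le> m}\<close> is a norm equivalent to the given one, and the
  even-odd balance makes \<open>T\<close> isometric for it: the maximum over the window \<open>{0..m}\<close> is attained at
  an even and at an odd index, so it survives the loss of one end point when the window is shifted
  (\<open>orbit_norm_invariant\<close>).  Everything else is true of any operator that is isometric for an
  equivalent norm.

  The reverse triangle inequality \<open>N (T x - \<lambda>x) \<ge> \<bar>1 - \<bar>\<lambda>\<bar>\<bar> N x\<close> keeps the approximate point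
  spectrum on the unit circle, and a Neumann series inverts \<open>T - \<lambda>\<close> when \<open>\<bar>\<lambda>\<bar> > 1\<close>, so the
  spectrum lies in the closed unit disc.  It remains to find a spectral value of modulus one, and
  here there is a route that avoids Liouville's theorem and the boundary of the spectrum.  If no
  point of the circle were an approximate eigenvalue, then by compactness \<open>\<lambda>T - 1\<close> would be bounded
  below by one constant \<open>c > 0\<close> for all unimodular \<open>\<lambda>\<close>.  As \<open>\<lambda>T - 1\<close> maps
  \<open>F\<^sub>n(\<lambda>) x = \<Sum>k<n. \<lambda>\<^sup>k T\<^sup>k x\<close> to \<open>\<lambda>\<^sup>n T\<^sup>n x - x\<close>, every \<open>F\<^sub>n(\<lambda>)\<close> would have norm at most
  \<open>2 / c\<close>, and its square at most \<open>4 / c\<^sup>2\<close>.  But the coefficient of \<open>\<lambda>\<^bsup>n-1\<^esup>\<close> in the square is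
  \<open>n T\<^bsup>n-1\<^esup>\<close>, which is \<open>n\<close> times an isometry, and the average of \<open>\<lambda> F\<^sub>n(\<lambda>)\<^sup>2\<close> over the \<open>n\<close>-th
  roots of unity recovers it (\<open>approx_point_spectrum_nonempty\<close>).  So \<open>n \<le> 4 / c\<^sup>2\<close> for every
  \<open>n > 0\<close>, which is absurd on a nonzero space.  Approximate eigenvalues are spectral values, so the
  supremum that defines the spectral radius is attained and equals one.
\<close>

section \<open>Complex scalar multiplication\<close>

instance complex_banach \<subseteq> banach ..

lemma scaleC_one: "1 *\<^sub>C x = (x::'a::complex_normed_vector)"
  using scaleC_of_real[of 1 x] by simp

lemma bounded_linear_scaleC: "bounded_linear (\<lambda>x::'a::complex_normed_vector. c *\<^sub>C x)"
proof (rule bounded_linear_intro[where K = "cmod c"])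
  fix r and x :: 'a
  show "c *\<^sub>C r *\<^sub>R x = r *\<^sub>R c *\<^sub>C x"
    by (simp add: scaleC_of_real[symmetric] scaleC_scaleC mult.commute)
qed (simp_all add: scaleC_add_right norm_scaleC mult.commute)

lemma bounded_linear_scaleC_left: "bounded_linear (\<lambda>c. c *\<^sub>C (x::'a::complex_normed_vector))"
proof (rule bounded_linear_intro[where K = "norm x"])
  fix r and c :: complex
  show "(r *\<^sub>R c) *\<^sub>C x = r *\<^sub>R c *\<^sub>C x"
    using scaleC_of_real[of r "c *\<^sub>C x"] by (simp add: scaleC_scaleC scaleR_conv_of_real)
qed (simp_all add: scaleC_add_left norm_scaleC)

lemmas scaleC_diff_right = linear_diff[OF bounded_linear.linear[OF bounded_linear_scaleC]]
  and scaleC_sum_right = linear_sum[OF bounded_linear.linear[OF bounded_linear_scaleC]]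
  and scaleC_diff_left = linear_diff[OF bounded_linear.linear[OF bounded_linear_scaleC_left]]
  and scaleC_sum_left = linear_sum[OF bounded_linear.linear[OF bounded_linear_scaleC_left]]
  and scaleC_zero_left = linear_0[OF bounded_linear.linear[OF bounded_linear_scaleC_left]]

section \<open>Averages over roots of unity\<close>

lemma sum_powers_roots_of_unity:
  assumes "n > 0"
  shows "(\<Sum>i<n. cis (2 * pi * real i / real n) ^ p) = (if n dvd p then of_nat n else 0)"
proof -
  define w where "w = cis (2 * pi * real p / real n)"
  have powers: "cis (2 * pi * real i / real n) ^ p = w ^ i" for i
    unfolding w_def Complex.DeMoivre by (rule arg_cong[where f = cis]) simp
  have "w ^ n = cis (2 * pi * real p)"
    using assms by (simp add: w_def Complex.DeMoivre)
  then have root: "w ^ n = 1"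
    using cis_multiple_2pi[of "real p"] by simp
  have "w = exp (2 * of_real pi * \<i> * of_nat p / of_nat n)"
    by (simp add: w_def cis_conv_exp mult_ac)
  then have one: "w = 1 \<longleftrightarrow> n dvd p"
    using complex_root_unity_eq_1[of n p] assms by simp
  show ?thesis
  proof (cases "w = 1")
    case True
    then show ?thesis using one by (simp add: powers)
  next
    case False
    then show ?thesis using one root by (simp add: powers geometric_sum)
  qed
qed

section \<open>Uniform lower bounds\<close>

text \<open>
  A lower bound at \<open>l\<close> is almost a lower bound at nearby points, so compactness makes it uniform.
\<close>

lemma bounded_below_uniform_on_compact:
  fixes T :: "'a::complex_normed_vector \<Rightarrow> 'a"
  assumes "compact S" and "S \<inter> approx_point_spectrum T = {}"
  shows "\<exists>c>0. \<forall>l\<in>S. \<forall>x. c * norm x \<le> norm (T x - l *\<^sub>C x)"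
proof (rule ccontr)
  assume neg: "\<not> ?thesis"
  have "\<exists>l x. l \<in> S \<and> norm (T x - l *\<^sub>C x) < inverse (real (Suc n)) * norm x" for n
    using neg by (meson inverse_positive_iff_positive not_less of_nat_0_less_iff zero_less_Suc)
  then obtain l x where l: "\<And>n. l n \<in> S"
    and small: "\<And>n. norm (T (x n) - l n *\<^sub>C x n) < inverse (real (Suc n)) * norm (x n)"
    by metis
  obtain l0 r where "l0 \<in> S" "strict_mono r" and lim: "(l \<circ> r) \<longlonglongrightarrow> l0"
    using assms(1) l unfolding compact_def by metis
  then obtain c where "c > 0" and c: "\<And>y. c * norm y \<le> norm (T y - l0 *\<^sub>C y)"
    using assms(2) unfolding approx_point_spectrum_def bounded_below_def by blast
  have "c \<le> inverse (real (Suc (r n))) + cmod (l (r n) - l0)" for n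
  proof -
    let ?y = "x (r n)" and ?l = "l (r n)"
    have "c * norm ?y \<le> norm ((T ?y - ?l *\<^sub>C ?y) + (?l - l0) *\<^sub>C ?y)"
      using c[of ?y] by (simp add: scaleC_diff_left)
    also have "\<dots> \<le> norm (T ?y - ?l *\<^sub>C ?y) + cmod (?l - l0) * norm ?y"
      by (metis norm_scaleC norm_triangle_ineq)
    also have "\<dots> \<le> (inverse (real (Suc (r n))) + cmod (?l - l0)) * norm ?y"
      using small[of "r n"] by (simp add: distrib_right)
    finally show ?thesis
      using small[of "r n"] by (cases "norm ?y = 0") (auto simp: mult_le_cancel_right)
  qed
  moreover have "(\<lambda>n. inverse (real (Suc (r n))) + cmod (l (r n) - l0)) \<longlonglongrightarrow> 0"
  proof -
    have "(\<lambda>n. inverse (real (Suc (r n)))) \<longlonglongrightarrow> 0"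
      using LIMSEQ_subseq_LIMSEQ[OF LIMSEQ_inverse_real_of_nat \<open>strict_mono r\<close>]
      by (simp add: o_def)
    moreover have "(\<lambda>n. cmod (l (r n) - l0)) \<longlonglongrightarrow> 0"
      using lim by (simp add: o_def LIM_zero_iff tendsto_norm_zero)
    ultimately show ?thesis
      using tendsto_add by fastforce
  qed
  ultimately have "c \<le> 0"
    by (intro LIMSEQ_le_const) auto
  with \<open>c > 0\<close> show False by simp
qed

section \<open>Isometries for an equivalent norm\<close>

locale renormed_isometry =
  fixes T :: "'a::complex_normed_vector \<Rightarrow> 'a" and N :: "'a \<Rightarrow> real" and K :: real
  assumes bounded_clinear: "bounded_clinear T"
    and N_triangle: "N (x + y) \<le> N x + N y"
    and N_scaleC: "N (c *\<^sub>C x) = cmod c * N x"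
    and norm_le_N: "norm x \<le> N x"
    and K_pos: "K > 0"
    and N_le_norm: "N x \<le> K * norm x"
    and N_isometry: "N (T x) = N x"
begin

lemma bounded_linear_T: "bounded_linear T"
  and T_scaleC: "T (c *\<^sub>C x) = c *\<^sub>C T x"
  using bounded_clinear by (auto simp: bounded_clinear_def)

lemmas T_sum = linear_sum[OF bounded_linear.linear[OF bounded_linear_T]]

lemma N_nonneg: "0 \<le> N x"
  using norm_le_N[of x] norm_ge_zero[of x] by linarith

lemma N_zero: "N 0 = 0"
  using N_scaleC[of 0 0] by (simp add: scaleC_zero_left)

lemma N_minus: "N (- x) = N x"
proof -
  have "(- 1) *\<^sub>C x = - x"
    using scaleC_of_real[of "- 1" x] by simp
  then show ?thesis using N_scaleC[of "- 1" x] by simp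
qed

lemma N_diff_ge: "N x - N y \<le> N (x - y)"
  using N_triangle[of "x - y" y] by simp

lemma N_diff_le: "N (x - y) \<le> N x + N y"
  using N_triangle[of x "- y"] N_minus[of y] by simp

lemma N_sum_le: "N (\<Sum>i\<in>I. f i) \<le> (\<Sum>i\<in>I. N (f i))"
proof (induction I rule: infinite_finite_induct)
  case (insert i I)
  then show ?case using N_triangle[of "f i" "\<Sum>i\<in>I. f i"] by simp
qed (simp_all add: N_zero)

lemma N_iterate: "N ((T ^^ k) x) = N x"
  by (induction k) (simp_all add: N_isometry)

lemma bounded_below_off_circle:
  assumes "cmod l \<noteq> 1"
  shows "bounded_below (\<lambda>x. T x - l *\<^sub>C x)"
  unfolding bounded_below_def
proof (intro exI conjI allI)
  show "\<bar>1 - cmod l\<bar> / K > 0"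
    using assms K_pos by simp
  fix x
  have "\<bar>1 - cmod l\<bar> * norm x \<le> \<bar>1 - cmod l\<bar> * N x"
    by (simp add: mult_left_mono norm_le_N)
  also have "\<dots> = \<bar>N (T x) - N (l *\<^sub>C x)\<bar>"
    using abs_mult_pos[OF N_nonneg[of x], of "1 - cmod l"]
    by (simp add: N_isometry N_scaleC left_diff_distrib)
  also have "\<dots> \<le> N (T x - l *\<^sub>C x)"
    using N_diff_ge[of "T x" "l *\<^sub>C x"] N_diff_ge[of "l *\<^sub>C x" "T x"] N_minus[of "T x - l *\<^sub>C x"]
    by simp
  also have "\<dots> \<le> K * norm (T x - l *\<^sub>C x)"
    by (rule N_le_norm)
  finally show "\<bar>1 - cmod l\<bar> / K * norm x \<le> norm (T x - l *\<^sub>C x)"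
    using K_pos by (simp add: field_simps)
qed

lemma approx_point_spectrum_subset_circle: "approx_point_spectrum T \<subseteq> {z. cmod z = 1}"
  using bounded_below_off_circle by (auto simp: approx_point_spectrum_def)

definition orbit_sum :: "nat \<Rightarrow> complex \<Rightarrow> 'a \<Rightarrow> 'a"
  where "orbit_sum n l x = (\<Sum>k<n. l ^ k *\<^sub>C (T ^^ k) x)"

lemma orbit_sum_telescopes:
  "l *\<^sub>C T (orbit_sum n l x) - orbit_sum n l x = l ^ n *\<^sub>C (T ^^ n) x - x"
proof -
  have "l *\<^sub>C T (orbit_sum n l x) - orbit_sum n l x
      = (\<Sum>k<n. l ^ Suc k *\<^sub>C (T ^^ Suc k) x - l ^ k *\<^sub>C (T ^^ k) x)"
    by (simp add: orbit_sum_def T_sum T_scaleC scaleC_sum_right scaleC_scaleC sum_subtractf)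
  also have "\<dots> = l ^ n *\<^sub>C (T ^^ n) x - x"
    using sum_lessThan_telescope[of "\<lambda>k. l ^ k *\<^sub>C (T ^^ k) x" n] by (simp add: scaleC_one)
  finally show ?thesis .
qed

lemma N_orbit_sum_le:
  assumes below: "\<And>y. c * N y \<le> N (l *\<^sub>C T y - y)" and "c > 0" and "cmod l = 1"
  shows "N (orbit_sum n l x) \<le> 2 / c * N x"
proof -
  have "c * N (orbit_sum n l x) \<le> N (l ^ n *\<^sub>C (T ^^ n) x - x)"
    using below[of "orbit_sum n l x"] by (simp add: orbit_sum_telescopes)
  also have "\<dots> \<le> 2 * N x"
    using N_diff_le[of "l ^ n *\<^sub>C (T ^^ n) x" x] \<open>cmod l = 1\<close>
    by (simp add: N_scaleC N_iterate norm_power)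
  finally show ?thesis
    using \<open>c > 0\<close> by (simp add: field_simps)
qed

lemma iterate_T_sum: "(T ^^ k) (\<Sum>i\<in>I. f i) = (\<Sum>i\<in>I. (T ^^ k) (f i))"
  by (induction k) (simp_all add: T_sum)

lemma iterate_T_scaleC: "(T ^^ k) (c *\<^sub>C x) = c *\<^sub>C (T ^^ k) x"
  by (induction k) (simp_all add: T_scaleC)

text \<open>
  The exponents \<open>1 + j + k\<close> with \<open>j, k < n\<close> lie strictly between \<open>0\<close> and \<open>2n\<close>, so the only multiple
  of \<open>n\<close> among them is \<open>n\<close> itself, which occurs for exactly one \<open>k\<close> for each \<open>j\<close>.
\<close>

lemma average_orbit_sum_square:
  assumes "n > 0"
  defines "w \<equiv> \<lambda>i. cis (2 * pi * real i / real n)"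
  shows "(\<Sum>i<n. w i *\<^sub>C orbit_sum n (w i) (orbit_sum n (w i) x))
    = (of_nat n * of_nat n) *\<^sub>C (T ^^ (n - 1)) x"
proof -
  have "(\<Sum>i<n. w i *\<^sub>C orbit_sum n (w i) (orbit_sum n (w i) x))
      = (\<Sum>i<n. \<Sum>j<n. \<Sum>k<n. w i ^ (1 + j + k) *\<^sub>C (T ^^ (j + k)) x)"
    by (simp add: orbit_sum_def iterate_T_sum iterate_T_scaleC scaleC_sum_right scaleC_scaleC
        power_add mult_ac funpow_add)
  also have "\<dots> = (\<Sum>j<n. \<Sum>k<n. \<Sum>i<n. w i ^ (1 + j + k) *\<^sub>C (T ^^ (j + k)) x)"
    by (subst sum.swap) (rule sum.cong[OF refl], rule sum.swap)
  also have "\<dots> = (\<Sum>j<n. \<Sum>k<n. if k = n - 1 - j then of_nat n *\<^sub>C (T ^^ (n - 1)) x else 0)"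
  proof (intro sum.cong refl)
    fix j k assume "j \<in> {..<n}" "k \<in> {..<n}"
    then have jk: "j < n" "k < n" by auto
    have dvd: "n dvd 1 + j + k \<longleftrightarrow> k = n - 1 - j"
    proof
      assume "n dvd 1 + j + k"
      then obtain q where q: "1 + j + k = n * q" by (elim dvdE)
      have "n * q < n * 2" using jk by (simp flip: q)
      moreover have "q \<noteq> 0" using q by (intro notI) simp
      ultimately have "q = 1" by simp
      with q show "k = n - 1 - j" by simp
    qed (use jk in simp)
    have "(\<Sum>i<n. w i ^ (1 + j + k) *\<^sub>C (T ^^ (j + k)) x)
        = (\<Sum>i<n. w i ^ (1 + j + k)) *\<^sub>C (T ^^ (j + k)) x"
      by (simp only: scaleC_sum_left)
    also have "\<dots> = (if k = n - 1 - j then of_nat n *\<^sub>C (T ^^ (n - 1)) x else 0)"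
      unfolding w_def sum_powers_roots_of_unity[OF \<open>n > 0\<close>] dvd
      using jk by (auto simp: scaleC_zero_left)
    finally show "(\<Sum>i<n. w i ^ (1 + j + k) *\<^sub>C (T ^^ (j + k)) x)
        = (if k = n - 1 - j then of_nat n *\<^sub>C (T ^^ (n - 1)) x else 0)" .
  qed
  also have "\<dots> = (\<Sum>j<n. of_nat n *\<^sub>C (T ^^ (n - 1)) x)"
    using \<open>n > 0\<close> by (intro sum.cong refl) (simp add: sum.delta')
  also have "\<dots> = (\<Sum>j<n. of_nat n) *\<^sub>C (T ^^ (n - 1)) x"
    by (simp only: scaleC_sum_left)
  finally show ?thesis by simp
qed

text \<open>
  Otherwise all \<open>orbit_sum n l\<close> with unimodular \<open>l\<close> are bounded by one constant, and so are their
  squares; but a unimodularly weighted average of the squares multiplies \<open>N\<close> by \<open>n\<close>.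
\<close>

lemma approx_point_spectrum_nonempty:
  assumes "\<exists>x::'a. x \<noteq> 0"
  shows "approx_point_spectrum T \<noteq> {}"
proof
  assume "approx_point_spectrum T = {}"
  then obtain b where "b > 0"
    and b: "\<And>l x. cmod l = 1 \<Longrightarrow> b * norm x \<le> norm (T x - l *\<^sub>C x)"
    using bounded_below_uniform_on_compact[OF compact_sphere[of 0 1], of T] by auto
  define c where "c = b / K"
  have "c > 0" using \<open>b > 0\<close> K_pos by (simp add: c_def)
  have below: "c * N x \<le> N (l *\<^sub>C T x - x)" if "cmod l = 1" for l x
  proof -
    have "l \<noteq> 0" using that by auto
    have "c * N x \<le> b * norm x"
      using mult_left_mono[OF N_le_norm[of x], of c] \<open>c > 0\<close> K_pos by (simp add: c_def)
    also have "\<dots> \<le> norm (T x - inverse l *\<^sub>C x)"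
      using that by (intro b) (simp add: norm_inverse)
    also have "\<dots> \<le> N (T x - inverse l *\<^sub>C x)"
      by (rule norm_le_N)
    also have "\<dots> = N (l *\<^sub>C (T x - inverse l *\<^sub>C x))"
      by (simp add: N_scaleC that)
    also have "l *\<^sub>C (T x - inverse l *\<^sub>C x) = l *\<^sub>C T x - x"
      using \<open>l \<noteq> 0\<close> by (simp add: scaleC_diff_right scaleC_scaleC scaleC_one)
    finally show ?thesis .
  qed
  obtain x :: 'a where "x \<noteq> 0" using assms by blast
  then have "N x > 0" using norm_le_N[of x] by (smt (verit) zero_less_norm_iff)
  have bound: "real n \<le> 4 / c\<^sup>2" if "n > 0" for n
  proof -
    define w where "w = (\<lambda>i. cis (2 * pi * real i / real n))"
    have w: "cmod (w i) = 1" for i by (simp add: w_def)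
    have "real n * real n * N x = N ((of_nat n * of_nat n) *\<^sub>C (T ^^ (n - 1)) x)"
      by (simp add: N_scaleC N_iterate norm_mult)
    also have "\<dots> = N (\<Sum>i<n. w i *\<^sub>C orbit_sum n (w i) (orbit_sum n (w i) x))"
      using average_orbit_sum_square[OF that, of x] by (simp add: w_def)
    also have "\<dots> \<le> (\<Sum>i<n. N (w i *\<^sub>C orbit_sum n (w i) (orbit_sum n (w i) x)))"
      by (rule N_sum_le)
    also have "\<dots> \<le> (\<Sum>i<n. 4 / c\<^sup>2 * N x)"
    proof (rule sum_mono)
      fix i
      have step: "N (orbit_sum n (w i) y) \<le> 2 / c * N y" for y
        using below[OF w] \<open>c > 0\<close> w by (rule N_orbit_sum_le)
      have "N (orbit_sum n (w i) (orbit_sum n (w i) x)) \<le> 2 / c * N (orbit_sum n (w i) x)"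
        by (rule step)
      also have "\<dots> \<le> 2 / c * (2 / c * N x)"
        using \<open>c > 0\<close> by (intro mult_left_mono step) simp
      finally show "N (w i *\<^sub>C orbit_sum n (w i) (orbit_sum n (w i) x)) \<le> 4 / c\<^sup>2 * N x"
        by (simp add: N_scaleC w power2_eq_square)
    qed
    finally have "real n * (real n * N x) \<le> real n * (4 / c\<^sup>2 * N x)"
      by (simp add: mult_ac)
    then have "real n * N x \<le> 4 / c\<^sup>2 * N x"
      using that by (simp only: mult_le_cancel_left_pos of_nat_0_less_iff)
    then show ?thesis
      using \<open>N x > 0\<close> by (simp only: mult_le_cancel_right_pos)
  qed
  obtain n :: nat where "real n > 4 / c\<^sup>2" using reals_Archimedean2 by blast
  then show False
    using bound[of "Suc n"] by simp
qed

end

section \<open>The spectrum\<close>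

lemma approx_point_spectrum_subset_spectrum:
  "approx_point_spectrum T \<subseteq> spectrum T"
proof
  fix l assume l: "l \<in> approx_point_spectrum T"
  show "l \<in> spectrum T"
  proof (rule ccontr)
    assume "l \<notin> spectrum T"
    then obtain S where S: "bounded_linear S" and inv: "S \<circ> (\<lambda>x. T x - l *\<^sub>C x) = id"
      by (auto simp: spectrum_def bounded_clinear_def)
    obtain B where "B > 0" and B: "\<And>y. norm (S y) \<le> norm y * B"
      using bounded_linear.pos_bounded[OF S] by blast
    have "inverse B * norm x \<le> norm (T x - l *\<^sub>C x)" for x
      using B[of "T x - l *\<^sub>C x"] fun_cong[OF inv, of x] \<open>B > 0\<close> by (simp add: field_simps)
    then have "bounded_below (\<lambda>x. T x - l *\<^sub>C x)"
      unfolding bounded_below_def using \<open>B > 0\<close> by (intro exI[of _ "inverse B"]) simp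
    with l show False by (simp add: approx_point_spectrum_def)
  qed
qed

text \<open>The inverse of a surjective operator inherits its norm bound from the lower bound.\<close>

lemma not_in_spectrum_if_bounded_below_surj:
  assumes T: "bounded_clinear T"
    and below: "bounded_below (\<lambda>x. T x - l *\<^sub>C x)" and surj: "surj (\<lambda>x. T x - l *\<^sub>C x)"
  shows "l \<notin> spectrum T"
proof -
  define A where "A = (\<lambda>x. T x - l *\<^sub>C x)"
  have T_lin: "linear T" and T_scaleC: "\<And>c x. T (c *\<^sub>C x) = c *\<^sub>C T x"
    using T by (auto simp: bounded_clinear_def bounded_linear.linear)
  have A_add: "A (x + y) = A x + A y" for x y
    by (simp add: A_def linear_add[OF T_lin] scaleC_add_right)
  have A_scaleC: "A (c *\<^sub>C x) = c *\<^sub>C A x" for c x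
    by (simp add: A_def T_scaleC scaleC_diff_right scaleC_scaleC mult.commute)
  have A_diff: "A (x - y) = A x - A y" for x y
    using A_add[of "x - y" y] by simp
  obtain c where "c > 0" and c: "\<And>x. c * norm x \<le> norm (A x)"
    using below by (auto simp: bounded_below_def A_def)
  have "inj A"
  proof (rule injI)
    fix x y assume "A x = A y"
    then have "c * norm (x - y) \<le> 0" using c[of "x - y"] by (simp add: A_diff)
    with \<open>c > 0\<close> show "x = y" by (simp add: mult_le_0_iff)
  qed
  define S where "S = inv A"
  have SA: "S (A x) = x" for x using \<open>inj A\<close> by (simp add: S_def)
  have AS: "A (S y) = y" for y using surj_f_inv_f[OF surj] by (simp add: S_def A_def)
  have S_scaleC: "S (a *\<^sub>C y) = a *\<^sub>C S y" for a y
    by (metis A_scaleC SA AS)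
  have "bounded_linear S"
  proof (rule bounded_linear_intro[where K = "inverse c"])
    show "S (x + y) = S x + S y" for x y by (metis A_add SA AS)
    show "S (r *\<^sub>R y) = r *\<^sub>R S y" for r y
      using S_scaleC[of "of_real r" y] by (simp add: scaleC_of_real)
    show "norm (S y) \<le> norm y * inverse c" for y
      using c[of "S y"] \<open>c > 0\<close> by (simp add: AS field_simps)
  qed
  then have "bounded_clinear S"
    using S_scaleC by (simp add: bounded_clinear_def)
  moreover have "S \<circ> A = id" "A \<circ> S = id"
    by (auto simp: SA AS)
  ultimately show ?thesis
    by (auto simp: spectrum_def A_def)
qed

text \<open>
  The Neumann series \<open>- (\<Sum>k. T\<^sup>k y / l\<^bsup>k+1\<^esup>)\<close> solves \<open>T x - l x = y\<close>: applying \<open>T\<close> to a term gives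
  \<open>l\<close> times the next one, so all terms but the first cancel.
\<close>

lemma surj_outside_disc:
  fixes T :: "'a::complex_banach \<Rightarrow> 'a"
  assumes "renormed_isometry T N K" and "cmod l > 1"
  shows "surj (\<lambda>x. T x - l *\<^sub>C x)"
proof -
  interpret renormed_isometry T N K by fact
  have "l \<noteq> 0" using assms(2) by auto
  show ?thesis unfolding surj_def
  proof
    fix y
    define u where "u = (\<lambda>k. (inverse l ^ Suc k) *\<^sub>C (T ^^ k) y)"
    have "norm (u k) \<le> N y * inverse (cmod l) ^ k" for k
    proof -
      have "norm (u k) \<le> N (u k)" by (rule norm_le_N)
      also have "\<dots> = inverse (cmod l) * (N y * inverse (cmod l) ^ k)"
        by (simp add: u_def N_scaleC N_iterate norm_mult norm_power norm_inverse mult_ac)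
      also have "\<dots> \<le> 1 * (N y * inverse (cmod l) ^ k)"
        using assms(2) N_nonneg[of y] by (intro mult_right_mono) (auto simp: inverse_le_1_iff)
      finally show ?thesis by simp
    qed
    moreover have "summable (\<lambda>k. N y * inverse (cmod l) ^ k)"
      using assms(2) by (intro summable_mult summable_geometric) (simp add: inverse_less_1_iff)
    ultimately have u: "summable u"
      by (intro summable_comparison_test[of u "\<lambda>k. N y * inverse (cmod l) ^ k"]) auto
    have cancel: "l * inverse l ^ Suc (Suc k) = inverse l ^ Suc k" for k
      using \<open>l \<noteq> 0\<close> by (simp add: field_simps)
    have shift: "T (u k) = l *\<^sub>C u (Suc k)" for k
      unfolding u_def T_scaleC scaleC_scaleC cancel by simp
    have "T (suminf u) = (\<Sum>k. l *\<^sub>C u (Suc k))"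
      using bounded_linear.suminf[OF bounded_linear_T u] by (simp add: shift)
    also have "\<dots> = l *\<^sub>C (\<Sum>k. u (Suc k))"
      using bounded_linear.suminf[OF bounded_linear_scaleC, of "\<lambda>k. u (Suc k)" l] u
      by (simp add: summable_Suc_iff)
    also have "\<dots> = l *\<^sub>C suminf u - l *\<^sub>C u 0"
      by (simp add: suminf_split_head[OF u] scaleC_diff_right)
    also have "l *\<^sub>C u 0 = y"
      using \<open>l \<noteq> 0\<close> by (simp add: u_def scaleC_scaleC scaleC_one)
    finally have "T (suminf u) = l *\<^sub>C suminf u - y" .
    moreover have "T (- suminf u) = - T (suminf u)" "l *\<^sub>C (- suminf u) = - (l *\<^sub>C suminf u)"
      using linear_neg[OF bounded_linear.linear[OF bounded_linear_T]]
        linear_neg[OF bounded_linear.linear[OF bounded_linear_scaleC]] by auto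
    ultimately show "\<exists>x. y = T x - l *\<^sub>C x"
      by (intro exI[of _ "- suminf u"]) simp
  qed
qed

theorem spectral_radius_renormed_isometry:
  fixes T :: "'a::complex_banach \<Rightarrow> 'a"
  assumes "renormed_isometry T N K" and "\<exists>x::'a. x \<noteq> 0"
  shows "spectral_radius T = 1"
proof -
  interpret renormed_isometry T N K by fact
  have disc: "cmod l \<le> 1" if "l \<in> spectrum T" for l
  proof (rule ccontr)
    assume "\<not> cmod l \<le> 1"
    then have "l \<notin> spectrum T"
      by (intro not_in_spectrum_if_bounded_below_surj bounded_clinear bounded_below_off_circle
          surj_outside_disc[OF assms(1)]) auto
    with that show False by simp
  qed
  obtain l where "l \<in> approx_point_spectrum T"
    using approx_point_spectrum_nonempty[OF assms(2)] by blast
  then have "l \<in> spectrum T" "cmod l = 1"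
    using approx_point_spectrum_subset_spectrum approx_point_spectrum_subset_circle by auto
  then show ?thesis
    unfolding spectral_radius_def by (intro cSup_eq_maximum) (auto intro: disc simp: image_iff)
qed

section \<open>The norm for which an \<open>(m,\<infinity>)\<close>-isometry is isometric\<close>

definition orbit_norm :: "nat \<Rightarrow> ('a::real_normed_vector \<Rightarrow> 'a) \<Rightarrow> 'a \<Rightarrow> real"
  where "orbit_norm m T x = Max ((\<lambda>k. norm ((T ^^ k) x)) ` {..m})"

lemma norm_iterate_le_orbit_norm: "k \<le> m \<Longrightarrow> norm ((T ^^ k) x) \<le> orbit_norm m T x"
  by (simp add: orbit_norm_def)

lemma orbit_norm_le: "(\<And>k. k \<le> m \<Longrightarrow> norm ((T ^^ k) x) \<le> b) \<Longrightarrow> orbit_norm m T x \<le> b"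
  by (auto simp: orbit_norm_def)

lemma orbit_norm_attained_both_parities:
  assumes "m \<ge> 1" and "m_infty_isometry m T"
  obtains i j where "i \<le> m" "even i" "norm ((T ^^ i) x) = orbit_norm m T x"
    and "j \<le> m" "odd j" "norm ((T ^^ j) x) = orbit_norm m T x"
proof -
  define f where "f = (\<lambda>k. norm ((T ^^ k) x))"
  define Ev Od where "Ev = {k. k \<le> m \<and> even k}" and "Od = {k. k \<le> m \<and> odd k}"
  have fin: "finite Ev" "finite Od" by (simp_all add: Ev_def Od_def)
  have "0 \<in> Ev" "1 \<in> Od" using assms(1) by (auto simp: Ev_def Od_def)
  then have ne: "Ev \<noteq> {}" "Od \<noteq> {}" by auto
  have balance: "Max (f ` Ev) = Max (f ` Od)"
    using assms(2) by (simp add: m_infty_isometry_def f_def Ev_def Od_def)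
  have "{..m} = Ev \<union> Od" by (auto simp: Ev_def Od_def)
  then have "orbit_norm m T x = max (Max (f ` Ev)) (Max (f ` Od))"
    using fin ne by (simp add: orbit_norm_def f_def image_Un Max_Un)
  then have max: "Max (f ` Ev) = orbit_norm m T x" "Max (f ` Od) = orbit_norm m T x"
    using balance by auto
  obtain i where "i \<in> Ev" "f i = orbit_norm m T x"
    using Max_in[of "f ` Ev"] fin ne unfolding max by (force elim: imageE)
  moreover obtain j where "j \<in> Od" "f j = orbit_norm m T x"
    using Max_in[of "f ` Od"] fin ne unfolding max by (force elim: imageE)
  ultimately show thesis
    by (intro that[of i j]) (auto simp: Ev_def Od_def f_def)
qed

text \<open>
  Passing from \<open>x\<close> to \<open>T x\<close> shifts the window of exponents from \<open>0, \<dots>, m\<close> to \<open>1, \<dots>, m + 1\<close>.  Each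
  maximum is attained at two indices of different parity, so at least one of them belongs to the
  other window as well.
\<close>

lemma orbit_norm_invariant:
  assumes "m \<ge> 1" and "m_infty_isometry m T"
  shows "orbit_norm m T (T x) = orbit_norm m T x"
proof (rule antisym)
  have shift: "(T ^^ k) (T y) = (T ^^ Suc k) y" for k y
    by (simp add: funpow_swap1)
  obtain i j where "i \<le> m" "j \<le> m" "even i" "odd j"
    and ij: "norm ((T ^^ i) (T x)) = orbit_norm m T (T x)"
      "norm ((T ^^ j) (T x)) = orbit_norm m T (T x)"
    using orbit_norm_attained_both_parities[OF assms, of "T x"] by metis
  then have "i \<noteq> j" by auto
  with \<open>i \<le> m\<close> \<open>j \<le> m\<close> have "Suc i \<le> m \<or> Suc j \<le> m" by linarith
  then show "orbit_norm m T (T x) \<le> orbit_norm m T x"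
    using ij norm_iterate_le_orbit_norm[of "Suc i" m T x] norm_iterate_le_orbit_norm[of "Suc j" m T x]
    unfolding shift by auto
  obtain j where "j \<le> m" "odd j" and j: "norm ((T ^^ j) x) = orbit_norm m T x"
    using orbit_norm_attained_both_parities[OF assms, of x] by metis
  then obtain k where "j = Suc k" by (cases j) auto
  then show "orbit_norm m T x \<le> orbit_norm m T (T x)"
    using j \<open>j \<le> m\<close> norm_iterate_le_orbit_norm[of k m T "T x"] by (simp add: funpow_swap1)
qed

lemma m_infty_isometry_renormed_isometry:
  fixes T :: "'a::complex_normed_vector \<Rightarrow> 'a"
  assumes T: "bounded_clinear T" and "m \<ge> 1" and "m_infty_isometry m T"
  obtains K where "renormed_isometry T (orbit_norm m T) K"
proof -
  have T_lin: "bounded_linear T" and T_scaleC: "\<And>c x. T (c *\<^sub>C x) = c *\<^sub>C T x"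
    using T by (auto simp: bounded_clinear_def)
  have pow_add: "(T ^^ k) (x + y) = (T ^^ k) x + (T ^^ k) y" for k x y
    by (induction k) (simp_all add: linear_add[OF bounded_linear.linear[OF T_lin]])
  have pow_scaleC: "(T ^^ k) (c *\<^sub>C x) = c *\<^sub>C (T ^^ k) x" for k c x
    by (induction k) (simp_all add: T_scaleC)
  obtain B0 where B0: "\<And>x. norm (T x) \<le> norm x * B0"
    using bounded_linear.bounded[OF T_lin] by blast
  \<comment> \<open>A bound of at least one makes the largest power dominate all smaller ones.\<close>
  define B where "B = max 1 B0"
  have "B \<ge> 1" by (simp add: B_def)
  have "norm (T x) \<le> B * norm x" for x
    using B0[of x] mult_left_mono[of B0 B "norm x"] by (simp add: B_def mult.commute)
  then have pow: "norm ((T ^^ k) x) \<le> B ^ k * norm x" for k x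
  proof (induction k)
    case (Suc k)
    have "norm ((T ^^ Suc k) x) \<le> B * norm ((T ^^ k) x)" using Suc.prems by simp
    also have "\<dots> \<le> B * (B ^ k * norm x)"
      using Suc \<open>B \<ge> 1\<close> by (intro mult_left_mono) auto
    finally show ?case by (simp add: mult_ac)
  qed simp
  have "renormed_isometry T (orbit_norm m T) (B ^ m)"
  proof
    fix x y c
    show "orbit_norm m T (x + y) \<le> orbit_norm m T x + orbit_norm m T y"
      by (intro orbit_norm_le)
        (metis pow_add norm_triangle_le add_mono norm_iterate_le_orbit_norm)
    show "orbit_norm m T (c *\<^sub>C x) = cmod c * orbit_norm m T x"
    proof -
      have "mono ((*) (cmod c))" by (simp add: mono_def mult_left_mono)
      then show ?thesis
        by (simp add: orbit_norm_def pow_scaleC norm_scaleC mono_Max_commute image_image)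
    qed
    show "norm x \<le> orbit_norm m T x"
      using norm_iterate_le_orbit_norm[of 0 m T x] by simp
    show "B ^ m > 0" using \<open>B \<ge> 1\<close> by simp
    show "orbit_norm m T x \<le> B ^ m * norm x"
    proof (rule orbit_norm_le)
      fix k assume "k \<le> m"
      then show "norm ((T ^^ k) x) \<le> B ^ m * norm x"
        using pow[of k x] mult_right_mono[OF power_increasing[OF _ \<open>B \<ge> 1\<close>], of k m "norm x"]
        by simp
    qed
    show "orbit_norm m T (T x) = orbit_norm m T x"
      using assms by (intro orbit_norm_invariant)
  qed (rule T)
  then show thesis by (rule that)
qed

theorem proposition6p5:
  fixes T :: "'a::complex_banach \<Rightarrow> 'a" and m :: nat
  assumes "bounded_clinear T"
    and "m \<ge> 1"
    and "m_infty_isometry m T"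
  shows "approx_point_spectrum T \<subseteq> {z. cmod z = 1} \<and>
    ((\<exists>x::'a. x \<noteq> 0) \<longrightarrow> spectral_radius T = 1)"
proof -
  obtain K where iso: "renormed_isometry T (orbit_norm m T) K"
    using m_infty_isometry_renormed_isometry[OF assms] .
  show ?thesis
    using renormed_isometry.approx_point_spectrum_subset_circle[OF iso]
      spectral_radius_renormed_isometry[OF iso] by blast
qed

end
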